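(* Suppose that for all contracts $(l,t)$ the utility of user $k$ is $U_{k,l,t}=(Y_{k,l,t}+X_k)^{+}$, where $x^+=\max\{x,0\}$, each $Y_{k,l,t}$ is a constant known to the charging station, and $X_k$ is a (real) random variable, not depending on $(l,t)$, whose realized value is not known to the charging station. Suppose that $$\zeta=\max\Big\{\gamma\ \Big|\ \gamma\in\operatorname{argmax}_{\beta\geq 0}\ \beta\,\max_{i,j}\Pr\big(U_{k,i,j}>\beta+v_{i,j}-v_{-k}\big)\Big\}$$ exists. Then the pricing strategy $$p_{k,l,t}=v_{l,t}-v_{-k}+\zeta\qquad (l\in\{1,\dots,L\},\ t\in\{t_k+1,\dots,T\})$$ maximizes the expected profit of the charging station $$\sum_{l=1}^{L}\sum_{t=t_k+1}^{T}(p_{k,l,t}-v_{l,t}+v_{-k})\Pr(R_{k,l,t})$$ over all price menus $\mathbf p_k=(p_{k,l,t})_{l,t}$ with $p_{k,l,t}\ge0$, where $R_{k,l,t}$ is the event that user $k$ selects contract $(l,t)$ under the menu $\mathbf p_k$.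
   Context: Contracts and user. User $k$ arrives at a charging station at time $t_k<T$ (discrete time, horizon $T$). A contract is a pair $(l,t)$ with energy level $l\in\{1,\dots,L\}$ and deadline $t\in\{t_k+1,\dots,T\}$. The station posts a price $p_{k,l,t}\ge 0$ for every contract, chosen without knowing the realized utilities (the value $+\infty$ is allowed; a contract with infinite price is never accepted, and its terms in all sums are read as $0$). User $k$'s utility for contract $(l,t)$ is the random variable $U_{k,l,t}$, whose realization $u_{k,l,t}$ is known to the user; its utility is $0$ if it rejects all contracts. The user selects at most one contract: if $\max_{i,j}(u_{k,i,j}-p_{k,i,j})\ge0$ it selects a contract attaining this maximum (ties between contracts may be broken in any way; ties between charging and not charging are resolved in favour of charging), and otherwise it selects none. The distribution of $X_k$ may be continuous or discrete. Costs. $\mathcal K_0$ is the set of users already present at time $t_k$; user $i\in\mathcal K_0$ has deadline $w_i$ and remaining demand $N_i$. Known data: conventional energy prices $c_t\ge0$, harvested energies $\bar E^t\ge 0$, maximal charging rate $R_{max}$, battery capacity $B_{max}$, initial battery level $B_0\in[0,B_{max}]$. For a contract $(l,d)$, $v_{l,d}$ is the optimal value of the linear program: minimize $\sum_{t=t_k}^{T-1}c_tq_t$ over nonnegative variables $r_{k,t},q_{k,t},r_{i,t},q_{i,t}\ (i\in\mathcal K_0),\,q_t,r_t,D_t$ (for $t_k\le t\le T-1$) and battery levels $B^t$, subject to (a) $\sum_{t=t_k}^{d-1}(r_{k,t}+q_{k,t})\ge l$; (b) $\sum_{t=t_k}^{w_i-1}(r_{i,t}+q_{i,t})\ge N_i$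 for all $i\in\mathcal K_0$; (c) $r_{k,t}+q_{k,t}\le R_{max}$ and $r_{i,t}+q_{i,t}\le R_{max}$ for all $i\in\mathcal K_0$ and all $t$; (d) $r_{k,t}+\sum_{i\in\mathcal K_0}r_{i,t}=r_t$ and $q_{k,t}+\sum_{i\in\mathcal K_0}q_{i,t}\le q_t$ for all $t$; (e) $B^{t+1}=B^t+\bar E^t-r_t+q_t-q_{k,t}-\sum_{i\in\mathcal K_0}q_{i,t}-D_t$, $0\le B^{t+1}\le B_{max}$, $B^{t_k}=B_0$, $B^T=B_0$. If the program is infeasible, $v_{l,d}=\infty$. $v_{-k}$ is the optimal value of the same program with $r_{k,t}=q_{k,t}=0$ for all $t$ and constraint (a) dropped (the cost of serving only the existing users), assumed finite. These costs do not depend on the prices, and $v_{l,t}-v_{-k}\ge 0$. *)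

theory Defs
  imports "HOL-Probability.Probability"
begin

text \<open>
  Time is discrete. The field \<open>arrival\<close> is the arrival time $t_k$ of the new user, \<open>horizon\<close> is
  $T$, and \<open>levels\<close> is $L$. The users already present have type \<open>'u\<close>.
\<close>

record 'u station =
  arrival :: nat
  horizon :: nat
  levels :: nat
  present :: "'u set"
  deadline :: "'u \<Rightarrow> nat"
  demand :: "'u \<Rightarrow> real"
  conv_price :: "nat \<Rightarrow> real"
  harvest :: "nat \<Rightarrow> real"
  max_rate :: real
  capacity :: real
  init_level :: real

text \<open>
  The bound on the deadlines is needed for \<open>old_demands_met\<close> to mention only the charging
  variables of the slots $t_k, \dots, T-1$.
\<close>

definition valid_station :: "'u station \<Rightarrow> bool" where
  "valid_station S \<longleftrightarrow>
     arrival S < horizon S \<and>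
     1 \<le> levels S \<and>
     finite (present S) \<and>
     (\<forall>i\<in>present S. deadline S i \<le> horizon S) \<and>
     (\<forall>t\<in>{arrival S..<horizon S}. 0 \<le> conv_price S t \<and> 0 \<le> harvest S t) \<and>
     0 \<le> init_level S \<and> init_level S \<le> capacity S"

definition contracts :: "'u station \<Rightarrow> (nat \<times> nat) set" where
  "contracts S = {1..levels S} \<times> {arrival S + 1..horizon S}"

text \<open>
  The decision variables: \<open>r_new\<close>, \<open>q_new\<close> are $r_{k,t}, q_{k,t}$; \<open>r_old\<close>, \<open>q_old\<close> are
  $r_{i,t}, q_{i,t}$ for the users already present; \<open>r_tot\<close>, \<open>q_tot\<close>, \<open>spill\<close> are
  $r_t, q_t, D_t$; and \<open>battery\<close> is $B^t$. Only the slots $t_k, \dots, T-1$ (and $T$ for the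
  battery) are constrained; values elsewhere are irrelevant.
\<close>

record 'u schedule =
  r_new :: "nat \<Rightarrow> real"
  q_new :: "nat \<Rightarrow> real"
  r_old :: "'u \<Rightarrow> nat \<Rightarrow> real"
  q_old :: "'u \<Rightarrow> nat \<Rightarrow> real"
  r_tot :: "nat \<Rightarrow> real"
  q_tot :: "nat \<Rightarrow> real"
  spill :: "nat \<Rightarrow> real"
  battery :: "nat \<Rightarrow> real"

definition nonneg_schedule :: "'u station \<Rightarrow> 'u schedule \<Rightarrow> bool" where
  "nonneg_schedule S s \<longleftrightarrow>
     (\<forall>t\<in>{arrival S..<horizon S}.
        0 \<le> r_new s t \<and> 0 \<le> q_new s t \<and>
        (\<forall>i\<in>present S. 0 \<le> r_old s i t \<and> 0 \<le> q_old s i t) \<and>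
        0 \<le> r_tot s t \<and> 0 \<le> q_tot s t \<and> 0 \<le> spill s t)"

definition new_demand_met :: "'u station \<Rightarrow> nat \<Rightarrow> nat \<Rightarrow> 'u schedule \<Rightarrow> bool" where
  "new_demand_met S l d s \<longleftrightarrow> (\<Sum>t = arrival S..<d. r_new s t + q_new s t) \<ge> real l"

definition old_demands_met :: "'u station \<Rightarrow> 'u schedule \<Rightarrow> bool" where
  "old_demands_met S s \<longleftrightarrow>
     (\<forall>i\<in>present S. (\<Sum>t = arrival S..<deadline S i. r_old s i t + q_old s i t) \<ge> demand S i)"

definition rates_ok :: "'u station \<Rightarrow> 'u schedule \<Rightarrow> bool" where
  "rates_ok S s \<longleftrightarrow>
     (\<forall>t\<in>{arrival S..<horizon S}.
        r_new s t + q_new s t \<le> max_rate S \<and>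
        (\<forall>i\<in>present S. r_old s i t + q_old s i t \<le> max_rate S))"

definition totals_ok :: "'u station \<Rightarrow> 'u schedule \<Rightarrow> bool" where
  "totals_ok S s \<longleftrightarrow>
     (\<forall>t\<in>{arrival S..<horizon S}.
        r_new s t + (\<Sum>i\<in>present S. r_old s i t) = r_tot s t \<and>
        q_new s t + (\<Sum>i\<in>present S. q_old s i t) \<le> q_tot s t)"

definition battery_ok :: "'u station \<Rightarrow> 'u schedule \<Rightarrow> bool" where
  "battery_ok S s \<longleftrightarrow>
     (\<forall>t\<in>{arrival S..<horizon S}.
        battery s (t + 1) =
          battery s t + harvest S t - r_tot s t + q_tot s t - q_new s t
            - (\<Sum>i\<in>present S. q_old s i t) - spill s t \<and>
        0 \<le> battery s (t + 1) \<and> battery s (t + 1) \<le> capacity S) \<and>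
     battery s (arrival S) = init_level S \<and>
     battery s (horizon S) = init_level S"

definition feasible_with :: "'u station \<Rightarrow> nat \<Rightarrow> nat \<Rightarrow> 'u schedule \<Rightarrow> bool" where
  "feasible_with S l d s \<longleftrightarrow>
     nonneg_schedule S s \<and> new_demand_met S l d s \<and> old_demands_met S s \<and>
     rates_ok S s \<and> totals_ok S s \<and> battery_ok S s"

definition feasible_without :: "'u station \<Rightarrow> 'u schedule \<Rightarrow> bool" where
  "feasible_without S s \<longleftrightarrow>
     nonneg_schedule S s \<and> old_demands_met S s \<and>
     rates_ok S s \<and> totals_ok S s \<and> battery_ok S s \<and>
     (\<forall>t\<in>{arrival S..<horizon S}. r_new s t = 0 \<and> q_new s t = 0)"

definition energy_cost :: "'u station \<Rightarrow> 'u schedule \<Rightarrow> real" where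
  "energy_cost S s = (\<Sum>t = arrival S..<horizon S. conv_price S t * q_tot s t)"

text \<open>
  The optimal values $v_{l,d}$ and $v_{-k}$. The infimum of the empty set in \<^typ>\<open>ereal\<close> is
  \<open>\<infinity>\<close>, which is the convention for an infeasible program.
\<close>

definition cost_with :: "'u station \<Rightarrow> nat \<Rightarrow> nat \<Rightarrow> ereal" where
  "cost_with S l d = (INF s \<in> {s. feasible_with S l d s}. ereal (energy_cost S s))"

definition cost_without :: "'u station \<Rightarrow> ereal" where
  "cost_without S = (INF s \<in> {s. feasible_without S s}. ereal (energy_cost S s))"

definition price_menu :: "'u station \<Rightarrow> (nat \<Rightarrow> nat \<Rightarrow> ereal) \<Rightarrow> bool" where
  "price_menu S p \<longleftrightarrow> (\<forall>(l, t)\<in>contracts S. 0 \<le> p l t)"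

definition best_net_utility ::
    "'u station \<Rightarrow> (nat \<Rightarrow> nat \<Rightarrow> real) \<Rightarrow> (nat \<Rightarrow> nat \<Rightarrow> ereal) \<Rightarrow> ereal" where
  "best_net_utility S u p = Max ((\<lambda>(i, j). ereal (u i j) - p i j) ` contracts S)"

text \<open>
  The choices compatible with realized utilities \<open>u\<close> and menu \<open>p\<close>; \<^const>\<open>None\<close> means that all
  contracts are rejected. Several contracts may be compatible (ties), but a best net utility of
  exactly \<open>0\<close> rules out rejection. An infinitely priced contract has net utility \<open>-\<infinity>\<close> and is
  never compatible.
\<close>

fun compatible_choice ::
    "'u station \<Rightarrow> (nat \<Rightarrow> nat \<Rightarrow> real) \<Rightarrow> (nat \<Rightarrow> nat \<Rightarrow> ereal) \<Rightarrow> (nat \<times> nat) option \<Rightarrow> bool" where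
  "compatible_choice S u p None \<longleftrightarrow> best_net_utility S u p < 0"
| "compatible_choice S u p (Some (l, t)) \<longleftrightarrow>
     best_net_utility S u p \<ge> 0 \<and> (l, t) \<in> contracts S \<and>
     ereal (u l t) - p l t = best_net_utility S u p"

text \<open>
  The event $R_{k,l,t}$, for a user whose choice in state \<open>\<omega>\<close> is \<open>sel \<omega>\<close>.
\<close>

definition selects ::
    "'w measure \<Rightarrow> ('w \<Rightarrow> (nat \<times> nat) option) \<Rightarrow> nat \<Rightarrow> nat \<Rightarrow> 'w set" where
  "selects M sel l t = {\<omega> \<in> space M. sel \<omega> = Some (l, t)}"

text \<open>
  A way for the user to respond to the menu \<open>p\<close>. Ties may be broken in any way, also depending
  on \<open>\<omega>\<close>, as long as the probabilities of the events $R_{k,l,t}$ are defined.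
\<close>

definition selection ::
    "'u station \<Rightarrow> 'w measure \<Rightarrow> (nat \<Rightarrow> nat \<Rightarrow> 'w \<Rightarrow> real) \<Rightarrow> (nat \<Rightarrow> nat \<Rightarrow> ereal) \<Rightarrow>
      ('w \<Rightarrow> (nat \<times> nat) option) \<Rightarrow> bool" where
  "selection S M U p sel \<longleftrightarrow>
     (\<forall>\<omega>\<in>space M. compatible_choice S (\<lambda>i j. U i j \<omega>) p (sel \<omega>)) \<and>
     (\<forall>(l, t)\<in>contracts S. selects M sel l t \<in> sets M)"

text \<open>
  No term of the sum is \<open>\<infinity>\<close>, so the sum is meaningful in \<^typ>\<open>ereal\<close>; it is \<open>-\<infinity>\<close> if a contract
  that cannot be served is selected with positive probability.
\<close>

definition expected_profit ::
    "'u station \<Rightarrow> 'w measure \<Rightarrow> (nat \<Rightarrow> nat \<Rightarrow> ereal) \<Rightarrow> ('w \<Rightarrow> (nat \<times> nat) option) \<Rightarrow> ereal" where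
  "expected_profit S M p sel =
     (\<Sum>l = 1..levels S. \<Sum>t = arrival S + 1..horizon S.
        if p l t = \<infinity> then 0
        else (p l t - cost_with S l t + cost_without S) * ereal (measure M (selects M sel l t)))"

definition margin_objective ::
    "'u station \<Rightarrow> 'w measure \<Rightarrow> (nat \<Rightarrow> nat \<Rightarrow> 'w \<Rightarrow> real) \<Rightarrow> real \<Rightarrow> real" where
  "margin_objective S M U \<beta> =
     \<beta> * Max ((\<lambda>(i, j). measure M {\<omega> \<in> space M.
                   ereal (U i j \<omega>) > ereal \<beta> + cost_with S i j - cost_without S}) ` contracts S)"

end

theory Submission
  imports Defs
begin

text \<open>
  Write \<open>c\<close> for the extra cost of a contract over serving only the existing users; the margin of
  a contract is its price minus \<open>c\<close>. Let \<open>G\<close> be the maximal value of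
  \<open>\<beta> * max Pr(U > \<beta> + c)\<close>. It bounds the profit of every menu, and the menu with constant margin
  \<open>\<zeta>\<close> earns at least \<open>G\<close>.

  The upper bound rests on the shape of the utilities. Since \<open>c \<ge> 0\<close>
  (\<open>cost_without_le_cost_with\<close>), a contract with positive margin has a positive price, so it is
  chosen only in states where its utility is positive, that is, equal to \<open>Y + X\<close>. There the
  choice is governed by the differences of the numbers \<open>Y - p\<close>, in which the unknown \<open>X\<close> cancels.
  Hence all contracts that ever sell with positive margin share the same value of \<open>Y - p\<close>, and
  whenever one of them is sold, the user could have accepted any other one of them instead
  (\<open>profitable_sales_interchangeable\<close>). Replacing each of these sales by a sale of the contract
  with the largest margin \<open>m\<close> among them shows that the profit is at most
  \<open>m * Pr(U \<ge> m + c)\<close> for a single contract. This is at most \<open>G\<close>: for \<open>\<beta> < m\<close> the event is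
  contained in \<open>U > \<beta> + c\<close>, and \<open>\<beta>\<close> may tend to \<open>m\<close> (\<open>single_contract_profit_le\<close>).

  Under the constant margin \<open>\<zeta>\<close>, every sale earns exactly \<open>\<zeta>\<close>, and a sale occurs whenever some
  contract satisfies \<open>U > \<zeta> + c\<close>, in particular when the one attaining the maximum in the
  objective does (\<open>uniform_margin_profit_ge\<close>).
\<close>

section \<open>Serving an additional user is never cheaper\<close>

text \<open>
  A schedule that serves the new user becomes one that does not: the energy destined for the new
  user is spilled instead. The battery levels and the purchases, hence the cost, are unchanged.
\<close>

lemma feasible_with_imp_feasible_without:
  assumes "feasible_with S l d s"
  shows "\<exists>s'. feasible_without S s' \<and> energy_cost S s' = energy_cost S s"
proof -
  define s' where "s' = s\<lparr>r_new := (\<lambda>_. 0), q_new := (\<lambda>_. 0),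
      r_tot := (\<lambda>t. r_tot s t - r_new s t),
      spill := (\<lambda>t. spill s t + r_new s t + q_new s t)\<rparr>"
  have nn: "nonneg_schedule S s" and old: "old_demands_met S s" and rates: "rates_ok S s"
    and tot: "totals_ok S s" and bat: "battery_ok S s"
    using assms by (auto simp: feasible_with_def)
  have nonneg_new: "0 \<le> r_new s t" "0 \<le> q_new s t" "0 \<le> r_new s t + q_new s t"
    if "t \<in> {arrival S..<horizon S}" for t
    using nn that by (auto simp: nonneg_schedule_def)
  have r_tot_ge: "r_new s t \<le> r_tot s t" if "t \<in> {arrival S..<horizon S}" for t
  proof -
    have "0 \<le> (\<Sum>i\<in>present S. r_old s i t)"
      using nn that by (intro sum_nonneg) (auto simp: nonneg_schedule_def)
    moreover have "r_new s t + (\<Sum>i\<in>present S. r_old s i t) = r_tot s t"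
      using tot that by (auto simp: totals_ok_def)
    ultimately show ?thesis by simp
  qed
  have "nonneg_schedule S s'"
    using nn r_tot_ge by (simp add: nonneg_schedule_def s'_def)
  moreover have "old_demands_met S s'"
    using old by (simp add: old_demands_met_def s'_def)
  moreover have "rates_ok S s'"
    using rates order_trans[OF nonneg_new(3)] by (simp add: rates_ok_def s'_def)
  moreover have "totals_ok S s'"
    unfolding totals_ok_def
  proof (intro ballI)
    fix t assume "t \<in> {arrival S..<horizon S}"
    then have "r_new s t + (\<Sum>i\<in>present S. r_old s i t) = r_tot s t"
      and "q_new s t + (\<Sum>i\<in>present S. q_old s i t) \<le> q_tot s t" and "0 \<le> q_new s t"
      using tot nonneg_new by (auto simp: totals_ok_def)
    then show "r_new s' t + (\<Sum>i\<in>present S. r_old s' i t) = r_tot s' t \<and>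
        q_new s' t + (\<Sum>i\<in>present S. q_old s' i t) \<le> q_tot s' t"
      by (simp add: s'_def)
  qed
  moreover have "battery_ok S s'"
    using bat by (auto simp: battery_ok_def s'_def)
  ultimately have "feasible_without S s'"
    by (simp add: feasible_without_def s'_def)
  moreover have "energy_cost S s' = energy_cost S s"
    by (simp add: energy_cost_def s'_def)
  ultimately show ?thesis by blast
qed

lemma cost_without_le_cost_with: "cost_without S \<le> cost_with S l d"
  unfolding cost_with_def
proof (rule INF_greatest)
  fix s assume "s \<in> {s. feasible_with S l d s}"
  then obtain s' where s': "feasible_without S s'" "energy_cost S s' = energy_cost S s"
    using feasible_with_imp_feasible_without by blast
  have "cost_without S \<le> ereal (energy_cost S s')"
    unfolding cost_without_def by (rule INF_lower) (simp add: s')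
  then show "cost_without S \<le> ereal (energy_cost S s)" by (simp add: s')
qed

section \<open>The charging market\<close>

lemma finite_contracts: "finite (contracts S)"
  by (simp add: contracts_def)

lemma contracts_nonempty: "valid_station S \<Longrightarrow> contracts S \<noteq> {}"
  by (auto simp: contracts_def valid_station_def)

locale charging_market = prob_space M
  for M :: "'w measure" +
  fixes S :: "'u station"
    and X :: "'w \<Rightarrow> real"
    and Y :: "nat \<Rightarrow> nat \<Rightarrow> real"
    and U :: "nat \<Rightarrow> nat \<Rightarrow> 'w \<Rightarrow> real"
  assumes valid: "valid_station S"
    and cost_without_finite: "\<bar>cost_without S\<bar> \<noteq> \<infinity>"
    and X_measurable: "X \<in> borel_measurable M"
    and utility: "\<And>l t \<omega>. (l, t) \<in> contracts S \<Longrightarrow> \<omega> \<in> space M \<Longrightarrow>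
      U l t \<omega> = max (Y l t + X \<omega>) 0"
begin

definition extra_cost :: "nat \<Rightarrow> nat \<Rightarrow> ereal" where
  "extra_cost l t = cost_with S l t - cost_without S"

lemma extra_cost_nonneg: "0 \<le> extra_cost l t"
  using cost_without_le_cost_with[of S l t] cost_without_finite
  unfolding extra_cost_def by (simp add: ereal_diff_positive)

lemma add_cost_diff: "x + cost_with S l t - cost_without S = x + extra_cost l t"
  if "x \<noteq> - \<infinity>"
  using cost_without_finite that cost_without_le_cost_with[of S l t] unfolding extra_cost_def
  by (cases x; cases "cost_with S l t"; cases "cost_without S") auto

lemma margin_eq: "p - cost_with S l t + cost_without S = p - extra_cost l t"
  if "p \<noteq> \<infinity>"
  using cost_without_finite that cost_without_le_cost_with[of S l t] unfolding extra_cost_def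
  by (cases p; cases "cost_with S l t"; cases "cost_without S") auto

lemma utility_measurable:
  assumes "(l, t) \<in> contracts S"
  shows "U l t \<in> borel_measurable M"
proof -
  have "(\<lambda>\<omega>. max (Y l t + X \<omega>) 0) \<in> borel_measurable M"
    using X_measurable by measurable
  then show ?thesis
    by (rule subst[OF measurable_cong, rotated]) (simp add: utility assms)
qed

lemma best_net_utility_ge:
  assumes "(l, t) \<in> contracts S"
  shows "ereal (u l t) - p l t \<le> best_net_utility S u p"
  unfolding best_net_utility_def
  using assms by (intro Max_ge) (force simp: finite_contracts)+

lemma selectsD:
  assumes "selection S M U p sel" and "\<omega> \<in> selects M sel l t"
  shows "\<omega> \<in> space M" and "(l, t) \<in> contracts S"
    and "0 \<le> ereal (U l t \<omega>) - p l t"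
    and "\<And>i j. (i, j) \<in> contracts S \<Longrightarrow>
      ereal (U i j \<omega>) - p i j \<le> ereal (U l t \<omega>) - p l t"
proof -
  show sp: "\<omega> \<in> space M" using assms(2) by (simp add: selects_def)
  then have "compatible_choice S (\<lambda>i j. U i j \<omega>) p (Some (l, t))"
    using assms by (force simp: selection_def selects_def)
  then show "(l, t) \<in> contracts S" "0 \<le> ereal (U l t \<omega>) - p l t"
    and "\<And>i j. (i, j) \<in> contracts S \<Longrightarrow>
      ereal (U i j \<omega>) - p i j \<le> ereal (U l t \<omega>) - p l t"
    using best_net_utility_ge[of _ _ "\<lambda>i j. U i j \<omega>" p] by auto
qed

lemma expected_profit_eq_sum_contracts:
  "expected_profit S M p sel =
    (\<Sum>(l, t)\<in>contracts S. if p l t = \<infinity> then 0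
       else (p l t - extra_cost l t) * ereal (prob (selects M sel l t)))"
  unfolding expected_profit_def contracts_def
  by (simp add: sum.cartesian_product margin_eq cong: if_cong)

lemma sale_probabilities_sum:
  assumes "selection S M U p sel" and "C \<subseteq> contracts S"
  shows "(\<Sum>(l, t)\<in>C. prob (selects M sel l t)) = prob (\<Union>(l, t)\<in>C. selects M sel l t)"
proof -
  have "prob (\<Union>i\<in>C. case_prod (selects M sel) i) = (\<Sum>i\<in>C. prob (case_prod (selects M sel) i))"
  proof (rule finite_measure_finite_Union)
    show "finite C" using assms(2) finite_contracts finite_subset by blast
    show "case_prod (selects M sel) ` C \<subseteq> events"
      using assms by (force simp: selection_def)
    show "disjoint_family_on (case_prod (selects M sel)) C"
      by (force simp: disjoint_family_on_def selects_def)
  qed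
  then show ?thesis by (simp add: case_prod_unfold)
qed

section \<open>Selling a single contract\<close>

lemma margin_objective_eq:
  "margin_objective S M U \<beta> =
    \<beta> * (MAX (i, j)\<in>contracts S. prob {\<omega> \<in> space M. ereal (U i j \<omega>) > ereal \<beta> + extra_cost i j})"
  unfolding margin_objective_def by (simp add: add_cost_diff)

lemma margin_objective_ge:
  assumes "0 \<le> \<beta>" and "(l, t) \<in> contracts S"
  shows "\<beta> * prob {\<omega> \<in> space M. ereal (U l t \<omega>) > ereal \<beta> + extra_cost l t}
    \<le> margin_objective S M U \<beta>"
  unfolding margin_objective_eq using assms
  by (intro mult_left_mono Max_ge) (force simp: finite_contracts)+

text \<open>
  The objective uses strict inequalities, whereas a user also buys at net utility exactly \<open>0\<close>. The
  difference disappears in the supremum over \<open>\<beta>\<close>: a slightly smaller margin turns indifference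
  into strict preference.
\<close>

lemma single_contract_profit_le:
  assumes max: "is_arg_max (margin_objective S M U) (\<lambda>\<beta>. \<beta> \<ge> 0) \<zeta>"
    and "0 < m" and lt: "(l, t) \<in> contracts S"
  shows "m * prob {\<omega> \<in> space M. ereal (U l t \<omega>) \<ge> ereal m + extra_cost l t}
    \<le> margin_objective S M U \<zeta>"
    (is "m * prob ?E \<le> ?G")
proof (cases "prob ?E = 0")
  case True
  have "0 \<le> ?G"
    using max \<open>0 < m\<close> margin_objective_ge[OF _ lt, of 0]
    by (force simp: is_arg_max_linorder margin_objective_def)
  with True show ?thesis by simp
next
  case False
  then have pos: "0 < prob ?E" by (simp add: zero_less_measure_iff)
  have "\<beta> * prob ?E \<le> ?G" if "0 < \<beta>" "\<beta> < m" for \<beta>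
  proof -
    let ?F = "{\<omega> \<in> space M. ereal (U l t \<omega>) > ereal \<beta> + extra_cost l t}"
    have "?E \<subseteq> ?F"
    proof
      fix \<omega> assume "\<omega> \<in> ?E"
      then show "\<omega> \<in> ?F" using that by (cases "extra_cost l t") auto
    qed
    moreover have "?F \<in> events"
      using utility_measurable[OF lt] by measurable
    ultimately have "\<beta> * prob ?E \<le> \<beta> * prob ?F"
      using that by (intro mult_left_mono finite_measure_mono) auto
    also have "\<dots> \<le> margin_objective S M U \<beta>"
      using that lt by (intro margin_objective_ge) auto
    also have "\<dots> \<le> ?G"
      using max that by (auto simp: is_arg_max_linorder)
    finally show ?thesis .
  qed
  then have "\<beta> \<le> ?G / prob ?E" if "0 < \<beta>" "\<beta> < m" for \<beta>
    using that pos pos_le_divide_eq by blast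
  with \<open>0 < m\<close> have "m \<le> ?G / prob ?E"
    by (rule dense_le_bounded)
  then show ?thesis using pos pos_le_divide_eq by blast
qed

section \<open>No menu beats the best single margin\<close>

definition profitable_contracts ::
    "(nat \<Rightarrow> nat \<Rightarrow> ereal) \<Rightarrow> ('w \<Rightarrow> (nat \<times> nat) option) \<Rightarrow> (nat \<times> nat) set" where
  "profitable_contracts p sel =
    {(l, t) \<in> contracts S. p l t \<noteq> \<infinity> \<and> 0 < p l t - extra_cost l t \<and> selects M sel l t \<noteq> {}}"

lemma profitable_contractsD:
  assumes "(l, t) \<in> profitable_contracts p sel"
  obtains a c where "p l t = ereal a" "extra_cost l t = ereal c" "0 \<le> c" "c < a"
  using assms extra_cost_nonneg[of l t]
  by (cases "p l t"; cases "extra_cost l t") (auto simp: profitable_contracts_def)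

text \<open>
  A profitable contract has a positive price, so its buyer has utility \<open>Y + X > 0\<close>. The state in
  which \<open>(i, j)\<close> is preferred to \<open>(l, t)\<close> yields a comparison of \<open>Y - p\<close> free of \<open>X\<close>, and this
  comparison carries over to the state in which \<open>(l, t)\<close> is bought.
\<close>

lemma profitable_sales_interchangeable:
  assumes sel: "selection S M U p sel"
    and ij: "(i, j) \<in> profitable_contracts p sel"
    and lt: "(l, t) \<in> profitable_contracts p sel" and \<omega>: "\<omega> \<in> selects M sel l t"
  shows "p i j \<le> ereal (U i j \<omega>)"
proof -
  obtain a c where a: "p i j = ereal a" "0 \<le> c" "c < a"
    using ij by (rule profitable_contractsD)
  obtain b d where b: "p l t = ereal b" "0 \<le> d" "d < b"
    using lt by (rule profitable_contractsD)
  obtain \<omega>\<^sub>0 where \<omega>\<^sub>0: "\<omega>\<^sub>0 \<in> selects M sel i j"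
    using ij by (auto simp: profitable_contracts_def)
  note at_\<omega> = selectsD[OF sel \<omega>] and at_\<omega>\<^sub>0 = selectsD[OF sel \<omega>\<^sub>0]
  have "b \<le> U l t \<omega>" using at_\<omega>(3) b by simp
  then have "b \<le> Y l t + X \<omega>" using utility[OF at_\<omega>(2,1)] b by (auto simp: max_def split: if_splits)
  have "a \<le> U i j \<omega>\<^sub>0" using at_\<omega>\<^sub>0(3) a by simp
  then have "U i j \<omega>\<^sub>0 = Y i j + X \<omega>\<^sub>0"
    using utility[OF at_\<omega>\<^sub>0(2,1)] a by (auto simp: max_def split: if_splits)
  moreover have "Y l t + X \<omega>\<^sub>0 \<le> U l t \<omega>\<^sub>0"
    using utility[OF at_\<omega>(2) at_\<omega>\<^sub>0(1)] by simp
  moreover have "U l t \<omega>\<^sub>0 - b \<le> U i j \<omega>\<^sub>0 - a"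
    using at_\<omega>\<^sub>0(4)[OF at_\<omega>(2)] a b by simp
  ultimately have "Y l t - b \<le> Y i j - a" by simp
  with \<open>b \<le> Y l t + X \<omega>\<close> have "a \<le> Y i j + X \<omega>" by simp
  also have "\<dots> \<le> U i j \<omega>"
    using utility[OF at_\<omega>\<^sub>0(2) at_\<omega>(1)] by simp
  finally show ?thesis using a by simp
qed

lemma expected_profit_le_profitable_sales:
  assumes m: "\<And>l t. (l, t) \<in> profitable_contracts p sel \<Longrightarrow> p l t - extra_cost l t \<le> ereal m"
    and sel: "selection S M U p sel"
  shows "expected_profit S M p sel
    \<le> ereal (m * prob (\<Union>(l, t)\<in>profitable_contracts p sel. selects M sel l t))"
proof -
  let ?C = "profitable_contracts p sel"
  have C: "?C \<subseteq> contracts S" by (auto simp: profitable_contracts_def)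
  have "expected_profit S M p sel \<le> (\<Sum>(l, t)\<in>contracts S.
      ereal (if (l, t) \<in> ?C then m * prob (selects M sel l t) else 0))"
    unfolding expected_profit_eq_sum_contracts
  proof (rule sum_mono, clarify)
    fix l t assume lt: "(l, t) \<in> contracts S"
    show "(if p l t = \<infinity> then 0 else (p l t - extra_cost l t) * ereal (prob (selects M sel l t)))
      \<le> ereal (if (l, t) \<in> ?C then m * prob (selects M sel l t) else 0)"
    proof (cases "(l, t) \<in> ?C")
      case True
      then have "(p l t - extra_cost l t) * ereal (prob (selects M sel l t))
          \<le> ereal m * ereal (prob (selects M sel l t))"
        by (intro ereal_mult_right_mono m) auto
      with True show ?thesis by (auto simp: profitable_contracts_def)
    next
      case False
      then consider "p l t = \<infinity>" | "p l t - extra_cost l t \<le> 0" | "selects M sel l t = {}"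
        using lt by (force simp: profitable_contracts_def)
      then show ?thesis
      proof cases
        case 2
        then have "(p l t - extra_cost l t) * ereal (prob (selects M sel l t)) \<le> 0"
          by (simp add: ereal_mult_le_0_iff)
        with False show ?thesis by (simp add: zero_ereal_def)
      qed (use False in \<open>simp_all flip: zero_ereal_def\<close>)
    qed
  qed
  also have "\<dots> = ereal (\<Sum>(l, t)\<in>contracts S.
      if (l, t) \<in> ?C then m * prob (selects M sel l t) else 0)"
    by (simp add: case_prod_unfold)
  also have "(\<Sum>(l, t)\<in>contracts S. if (l, t) \<in> ?C then m * prob (selects M sel l t) else 0)
      = (\<Sum>(l, t)\<in>?C. m * prob (selects M sel l t))"
    using C by (intro sum.mono_neutral_cong_right) (auto simp: finite_contracts)
  also have "\<dots> = m * (\<Sum>(l, t)\<in>?C. prob (selects M sel l t))"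
    by (simp add: sum_distrib_left case_prod_unfold)
  also have "\<dots> = m * prob (\<Union>(l, t)\<in>?C. selects M sel l t)"
    using sale_probabilities_sum[OF sel C] by simp
  finally show ?thesis .
qed

lemma expected_profit_le:
  assumes max: "is_arg_max (margin_objective S M U) (\<lambda>\<beta>. \<beta> \<ge> 0) \<zeta>"
    and sel: "selection S M U p sel"
  shows "expected_profit S M p sel \<le> ereal (margin_objective S M U \<zeta>)"
proof (cases "profitable_contracts p sel = {}")
  case True
  have "expected_profit S M p sel \<le> 0"
    using expected_profit_le_profitable_sales[of p sel 0] sel True by (simp add: zero_ereal_def)
  also have "0 \<le> ereal (margin_objective S M U \<zeta>)"
    using max by (force simp: is_arg_max_linorder margin_objective_def)
  finally show ?thesis .
next
  case False
  let ?C = "profitable_contracts p sel"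
  let ?margin = "\<lambda>(l, t). p l t - extra_cost l t"
  have C: "?C \<subseteq> contracts S" by (auto simp: profitable_contracts_def)
  have fin: "finite ?C" using C finite_contracts finite_subset by blast
  obtain y where y: "y \<in> ?C" "Max (?margin ` ?C) = ?margin y"
    using obtains_MAX[OF fin False] by blast
  obtain i j where y_eq: "y = (i, j)" by (cases y)
  have ij: "(i, j) \<in> ?C" using y(1) unfolding y_eq .
  have best: "?margin x \<le> ?margin (i, j)" if "x \<in> ?C" for x
    unfolding y_eq[symmetric] y(2)[symmetric] using fin that by (intro Max_ge finite_imageI imageI)
  obtain a c where a: "p i j = ereal a" "extra_cost i j = ereal c" "0 \<le> c" "c < a"
    using ij by (rule profitable_contractsD)
  have ijS: "(i, j) \<in> contracts S" using ij C by auto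
  let ?E = "{\<omega> \<in> space M. ereal (U i j \<omega>) \<ge> ereal (a - c) + extra_cost i j}"
  have "expected_profit S M p sel \<le> ereal ((a - c) * prob (\<Union>(l, t)\<in>?C. selects M sel l t))"
  proof (rule expected_profit_le_profitable_sales[OF _ sel])
    fix l t assume "(l, t) \<in> ?C"
    then show "p l t - extra_cost l t \<le> ereal (a - c)"
      using best[of "(l, t)"] a by simp
  qed
  also have "\<dots> \<le> ereal ((a - c) * prob ?E)"
  proof -
    have "(\<Union>(l, t)\<in>?C. selects M sel l t) \<subseteq> ?E"
      using profitable_sales_interchangeable[OF sel ij] a by (force simp: selects_def)
    moreover have "?E \<in> events"
      using utility_measurable[OF ijS] by measurable
    ultimately show ?thesis
      using a by (auto intro!: mult_left_mono finite_measure_mono)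
  qed
  also have "\<dots> \<le> ereal (margin_objective S M U \<zeta>)"
    using single_contract_profit_le[OF max _ ijS, of "a - c"] a by simp
  finally show ?thesis .
qed

section \<open>The profit of a uniform margin\<close>

text \<open>
  All served contracts have the same margin, so it does not matter which of them the user buys, only
  that something is bought; this happens whenever any given contract is worth its price.
\<close>

lemma uniform_margin_profit_ge:
  assumes "0 \<le> \<beta>" and sel: "selection S M U (\<lambda>l t. extra_cost l t + ereal \<beta>) sel"
  shows "ereal (margin_objective S M U \<beta>)
    \<le> expected_profit S M (\<lambda>l t. extra_cost l t + ereal \<beta>) sel"
proof -
  let ?p = "\<lambda>l t. extra_cost l t + ereal \<beta>"
  let ?A = "\<lambda>(i, j). {\<omega> \<in> space M. ereal (U i j \<omega>) > ereal \<beta> + extra_cost i j}"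
  define C where "C = {(l, t) \<in> contracts S. extra_cost l t \<noteq> \<infinity>}"
  have C: "C \<subseteq> contracts S" by (auto simp: C_def)
  obtain y where y: "y \<in> contracts S" "(MAX x\<in>contracts S. prob (?A x)) = prob (?A y)"
    using obtains_MAX[OF finite_contracts contracts_nonempty[OF valid]] by blast
  obtain i j where y_eq: "y = (i, j)" by (cases y)
  have ij: "(i, j) \<in> contracts S" using y(1) unfolding y_eq .
  have obj: "margin_objective S M U \<beta> = \<beta> * prob (?A (i, j))"
    using y(2) unfolding margin_objective_eq y_eq by (simp add: case_prod_unfold)
  have "?A (i, j) \<subseteq> (\<Union>(l, t)\<in>C. selects M sel l t)"
  proof
    fix \<omega> assume \<omega>: "\<omega> \<in> ?A (i, j)"
    then have "0 \<le> ereal (U i j \<omega>) - ?p i j"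
      using extra_cost_nonneg[of i j] by (cases "extra_cost i j") auto
    also have "\<dots> \<le> best_net_utility S (\<lambda>i j. U i j \<omega>) ?p"
      using best_net_utility_ge[OF ij] .
    finally have not_rejected: "\<not> compatible_choice S (\<lambda>i j. U i j \<omega>) ?p None"
      by simp
    have "sel \<omega> \<noteq> None"
    proof
      assume "sel \<omega> = None"
      moreover have "compatible_choice S (\<lambda>i j. U i j \<omega>) ?p (sel \<omega>)"
        using sel \<omega> unfolding selection_def by blast
      ultimately show False
        using not_rejected by simp
    qed
    then obtain l t where lt: "\<omega> \<in> selects M sel l t"
      using \<omega> by (auto simp: selects_def)
    have "(l, t) \<in> C"
      using selectsD(2,3)[OF sel lt] unfolding C_def by auto
    with lt show "\<omega> \<in> (\<Union>(l, t)\<in>C. selects M sel l t)" by blast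
  qed
  moreover have "(\<Union>(l, t)\<in>C. selects M sel l t) \<in> events"
    using sel C finite_subset[OF C finite_contracts]
    by (intro sets.finite_UN) (force simp: selection_def)+
  ultimately have "margin_objective S M U \<beta> \<le> \<beta> * prob (\<Union>(l, t)\<in>C. selects M sel l t)"
    unfolding obj using \<open>0 \<le> \<beta>\<close> by (intro mult_left_mono finite_measure_mono)
  also have "\<dots> = (\<Sum>(l, t)\<in>C. \<beta> * prob (selects M sel l t))"
    using sale_probabilities_sum[OF sel C, symmetric] by (simp add: sum_distrib_left case_prod_unfold)
  finally have "ereal (margin_objective S M U \<beta>) \<le> (\<Sum>(l, t)\<in>C. ereal (\<beta> * prob (selects M sel l t)))"
    by (simp add: case_prod_unfold)
  also have "\<dots> = expected_profit S M ?p sel"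
    unfolding expected_profit_eq_sum_contracts
  proof (rule sum.mono_neutral_cong_left[OF finite_contracts C])
    fix x assume "x \<in> C"
    then show "(case x of (l, t) \<Rightarrow> ereal (\<beta> * prob (selects M sel l t))) =
      (case x of (l, t) \<Rightarrow> if ?p l t = \<infinity> then 0
         else (?p l t - extra_cost l t) * ereal (prob (selects M sel l t)))"
      using extra_cost_nonneg[of "fst x" "snd x"]
      by (cases x; cases "extra_cost (fst x) (snd x)") (auto simp: C_def)
  qed (auto simp: C_def)
  finally show ?thesis .
qed

end

section \<open>Optimality of the uniform margin\<close>

theorem theorem7:
  fixes S :: "'u station"
    and M :: "'w measure"
    and X :: "'w \<Rightarrow> real"
    and Y :: "nat \<Rightarrow> nat \<Rightarrow> real"
    and U :: "nat \<Rightarrow> nat \<Rightarrow> 'w \<Rightarrow> real"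
    and sel :: "(nat \<Rightarrow> nat \<Rightarrow> ereal) \<Rightarrow> 'w \<Rightarrow> (nat \<times> nat) option"
    and \<zeta> :: real
  assumes "valid_station S"
    and "\<bar>cost_without S\<bar> \<noteq> \<infinity>"
    and "prob_space M"
    and "X \<in> borel_measurable M"
    and "\<And>l t \<omega>. (l, t) \<in> contracts S \<Longrightarrow> \<omega> \<in> space M \<Longrightarrow> U l t \<omega> = max (Y l t + X \<omega>) 0"
    and "\<And>p. price_menu S p \<Longrightarrow> selection S M U p (sel p)"
    and "is_arg_max (margin_objective S M U) (\<lambda>\<beta>. \<beta> \<ge> 0) \<zeta>"
    and "\<And>\<gamma>. is_arg_max (margin_objective S M U) (\<lambda>\<beta>. \<beta> \<ge> 0) \<gamma> \<Longrightarrow> \<gamma> \<le> \<zeta>"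
  shows "is_arg_max (\<lambda>p. expected_profit S M p (sel p)) (price_menu S)
           (\<lambda>l t. cost_with S l t - cost_without S + ereal \<zeta>)"
proof -
  interpret charging_market M S X Y U
    using assms(1-5) by (simp add: charging_market_def charging_market_axioms_def)
  let ?p = "\<lambda>l t. extra_cost l t + ereal \<zeta>"
  have "0 \<le> \<zeta>" using assms(7) by (simp add: is_arg_max_def)
  then have menu: "price_menu S ?p"
    using extra_cost_nonneg by (auto simp: price_menu_def)
  have "expected_profit S M q (sel q) \<le> expected_profit S M ?p (sel ?p)" if "price_menu S q" for q
    using expected_profit_le[OF assms(7) assms(6)[OF that]]
      uniform_margin_profit_ge[OF \<open>0 \<le> \<zeta>\<close> assms(6)[OF menu]]
    by (rule order_trans)
  with menu have "is_arg_max (\<lambda>p. expected_profit S M p (sel p)) (price_menu S) ?p"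
    by (simp add: is_arg_max_linorder)
  then show ?thesis by (simp only: extra_cost_def)
qed

end
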